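(* If $K$ is a compact semihypergroup, then $AP(K)=WAP_l(K)=WAP_r(K)=C(K)$.
   Context: All topologies are Hausdorff. For a locally compact Hausdorff space $X$: $M(X)$ is the space of regular complex Borel measures on $X$; $M^+(X)$ is the set of finite non-negative regular Borel measures, with the cone topology (the weakest topology making $\mu\mapsto\int_X f\,d\mu$ continuous for every $f\in C_c^+(X)\cup\{1_X\}$, where $C_c^+(X)$ is the set of non-negative compactly supported continuous functions and $1_X$ is the constant function $1$); $\mathfrak{C}(X)$ is the set of compact subsets of $X$ with the Michael topology, generated by the sub-basis of sets $\{C\in\mathfrak{C}(X): C\cap U\neq\emptyset,\ C\subset V\}$ for $U,V$ open in $X$; $p_x$ is the point mass at $x$. A semihypergroup is a pair $(K,* )$ such that: (A1) $K$ is a locally compact Hausdorff space and $*$ is a binary operation making $M(K)$ an associative algebra; (A2) the bilinear map $*$ sends $M^+(K)\times M^+(K)$ into $M^+(K)$ and its restriction to $M^+(K)\times M^+(K)$ is (jointly) continuous; (A3) for all $x,y\in K$, $p_x*p_y$ is a probability measure with compact support; (A4) the map $(x,y)\mapsto \mathrm{supp}(p_x*p_y)$, $K\times K\to\mathfrak{C}(K)$, is continuous. It is compact if $K$ is compact. $C(K)$ is the space of bounded continuous complex-valued functions on $K$ with the supremum norm. For measurable $f$ on $K$ and $x,y\in K$, $L_xf(y)=R_yf(x)=f(x*y):=\int_K f\,d(p_x*p_y)$. For $f\in C(K)$, $\mathcal{O}_r(f)=\{R_xf:x\in K\}$ and $\mathcal{O}_l(f)=\{L_xf:x\in K\}$.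 $WAP_r(K)$ (resp. $WAP_l(K)$) is the set of $f\in C(K)$ with $\mathcal{O}_r(f)$ (resp. $\mathcal{O}_l(f)$) relatively compact in the weak topology of $C(K)$; $AP_r(K)$ (resp. $AP_l(K)$) is the set of $f\in C(K)$ with $\mathcal{O}_r(f)$ (resp. $\mathcal{O}_l(f)$) relatively compact in the norm topology. For a semihypergroup $AP_l(K)=AP_r(K)$, and $AP(K)$ denotes this common space. *)

theory Defs
  imports "HOL-Analysis.Analysis"
begin

text \<open>
  A locally compact Hausdorff space is a type \<open>'a::t2_space\<close> whose euclidean topology is locally
  compact. A complex Borel measure is a set function \<open>'a set \<Rightarrow> complex\<close> that is countably
  additive on the Borel sets; by convention it vanishes on non-Borel sets, so that equality of set
  functions is equality of measures.
\<close>

definition complex_borel_measure :: "('a::topological_space set \<Rightarrow> complex) \<Rightarrow> bool" where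
  "complex_borel_measure \<mu> \<longleftrightarrow>
     (\<forall>E. E \<notin> sets borel \<longrightarrow> \<mu> E = 0) \<and>
     (\<forall>A :: nat \<Rightarrow> 'a set. range A \<subseteq> sets borel \<longrightarrow> disjoint_family A \<longrightarrow>
        (\<lambda>i. \<mu> (A i)) sums \<mu> (\<Union>i. A i))"

definition total_variation :: "('a::topological_space set \<Rightarrow> complex) \<Rightarrow> 'a set \<Rightarrow> ennreal" where
  "total_variation \<mu> E =
     (SUP A \<in> {A :: nat \<Rightarrow> 'a set. range A \<subseteq> sets borel \<and> disjoint_family A \<and> (\<Union>i. A i) = E}.
        \<Sum>i. ennreal (cmod (\<mu> (A i))))"

definition regular_complex_measure :: "('a::topological_space set \<Rightarrow> complex) \<Rightarrow> bool" where
  "regular_complex_measure \<mu> \<longleftrightarrow>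
     (\<forall>E \<in> sets borel.
        total_variation \<mu> E = (INF U \<in> {U. open U \<and> E \<subseteq> U}. total_variation \<mu> U) \<and>
        total_variation \<mu> E = (SUP C \<in> {C. compact C \<and> C \<subseteq> E}. total_variation \<mu> C))"

definition complex_measures :: "('a::topological_space set \<Rightarrow> complex) set"  (\<open>\<M>\<close>) where
  "\<M> = {\<mu>. complex_borel_measure \<mu> \<and> regular_complex_measure \<mu>}"

definition pos_measures :: "('a::topological_space set \<Rightarrow> complex) set"  (\<open>\<M>\<^sub>+\<close>) where
  "\<M>\<^sub>+ = {\<mu> \<in> \<M>. \<forall>E. \<mu> E \<in> \<real>\<^sub>\<ge>\<^sub>0}"

text \<open>The library measure given by an element of \<open>\<M>\<^sub>+\<close>; used only for such elements.\<close>

definition to_measure :: "('a::topological_space set \<Rightarrow> complex) \<Rightarrow> 'a measure" where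
  "to_measure \<mu> = measure_of UNIV (sets borel) (\<lambda>E. ennreal (Re (\<mu> E)))"

definition point_mass :: "'a::topological_space \<Rightarrow> 'a set \<Rightarrow> complex" where
  "point_mass x = (\<lambda>E. if E \<in> sets borel then indicator E x else 0)"

definition measure_support :: "('a::topological_space set \<Rightarrow> complex) \<Rightarrow> 'a set" where
  "measure_support \<mu> = - \<Union>{U. open U \<and> emeasure (to_measure \<mu>) U = 0}"

definition Cc_plus :: "('a::topological_space \<Rightarrow> real) set" where
  "Cc_plus = {f. continuous_on UNIV f \<and> (\<forall>x. 0 \<le> f x) \<and> compact (closure {x. f x \<noteq> 0})}"

definition cone_topology :: "('a::topological_space set \<Rightarrow> complex) topology" where
  "cone_topology = topology_generated_by
     {{\<mu> \<in> \<M>\<^sub>+. (\<integral>x. f x \<partial>to_measure \<mu>) \<in> W} |f W. f \<in> Cc_plus \<union> {\<lambda>_. 1} \<and> open W}"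

text \<open>
  The set of all compact sets is added to the sub-basis because the library's generated topology
  lives on the union of its generators, which would otherwise omit the empty set.
\<close>

definition michael_topology :: "'a::topological_space set topology" where
  "michael_topology = topology_generated_by
     (insert {C. compact C} {{C. compact C \<and> C \<inter> U \<noteq> {} \<and> C \<subseteq> V} |U V. open U \<and> open V})"

locale semihypergroup =
  fixes conv :: "('a::t2_space set \<Rightarrow> complex) \<Rightarrow> ('a set \<Rightarrow> complex) \<Rightarrow> 'a set \<Rightarrow> complex"
    (infixl \<open>\<star>\<close> 70)
  assumes locally_compact: "locally_compact_space (euclidean :: 'a topology)"
    and conv_closed: "\<lbrakk>\<mu> \<in> \<M>; \<nu> \<in> \<M>\<rbrakk> \<Longrightarrow> \<mu> \<star> \<nu> \<in> \<M>"
    and conv_add_left: "\<lbrakk>\<mu> \<in> \<M>; \<mu>' \<in> \<M>; \<nu> \<in> \<M>\<rbrakk> \<Longrightarrow>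
          (\<lambda>E. \<mu> E + \<mu>' E) \<star> \<nu> = (\<lambda>E. (\<mu> \<star> \<nu>) E + (\<mu>' \<star> \<nu>) E)"
    and conv_add_right: "\<lbrakk>\<mu> \<in> \<M>; \<nu> \<in> \<M>; \<nu>' \<in> \<M>\<rbrakk> \<Longrightarrow>
          \<mu> \<star> (\<lambda>E. \<nu> E + \<nu>' E) = (\<lambda>E. (\<mu> \<star> \<nu>) E + (\<mu> \<star> \<nu>') E)"
    and conv_scale_left: "\<lbrakk>\<mu> \<in> \<M>; \<nu> \<in> \<M>\<rbrakk> \<Longrightarrow>
          (\<lambda>E. c * \<mu> E) \<star> \<nu> = (\<lambda>E. c * (\<mu> \<star> \<nu>) E)"
    and conv_scale_right: "\<lbrakk>\<mu> \<in> \<M>; \<nu> \<in> \<M>\<rbrakk> \<Longrightarrow>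
          \<mu> \<star> (\<lambda>E. c * \<nu> E) = (\<lambda>E. c * (\<mu> \<star> \<nu>) E)"
    and conv_assoc: "\<lbrakk>\<mu> \<in> \<M>; \<nu> \<in> \<M>; \<rho> \<in> \<M>\<rbrakk> \<Longrightarrow> (\<mu> \<star> \<nu>) \<star> \<rho> = \<mu> \<star> (\<nu> \<star> \<rho>)"
    and conv_pos: "\<lbrakk>\<mu> \<in> \<M>\<^sub>+; \<nu> \<in> \<M>\<^sub>+\<rbrakk> \<Longrightarrow> \<mu> \<star> \<nu> \<in> \<M>\<^sub>+"
    and conv_continuous:
          "continuous_map (prod_topology cone_topology cone_topology) cone_topology (\<lambda>(\<mu>, \<nu>). \<mu> \<star> \<nu>)"
    and conv_prob: "(point_mass x \<star> point_mass y) UNIV = 1"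
    and conv_compact_support: "compact (measure_support (point_mass x \<star> point_mass y))"
    and conv_support_continuous:
          "continuous_map (prod_topology euclidean euclidean) michael_topology
             (\<lambda>(x, y). measure_support (point_mass x \<star> point_mass y))"

type_synonym 'a convolution = "('a set \<Rightarrow> complex) \<Rightarrow> ('a set \<Rightarrow> complex) \<Rightarrow> 'a set \<Rightarrow> complex"

text \<open>\<open>conv_eval conv f x y\<close> is the value usually written \<open>f(x * y)\<close>.\<close>

definition conv_eval ::
    "'a::topological_space convolution \<Rightarrow> ('a \<Rightarrow> complex) \<Rightarrow> 'a \<Rightarrow> 'a \<Rightarrow> complex" where
  "conv_eval conv f x y = (\<integral>z. f z \<partial>to_measure (conv (point_mass x) (point_mass y)))"

definition left_translate ::
    "'a::topological_space convolution \<Rightarrow> 'a \<Rightarrow> ('a \<Rightarrow> complex) \<Rightarrow> 'a \<Rightarrow> complex" where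
  "left_translate conv x f = (\<lambda>y. conv_eval conv f x y)"

definition right_translate ::
    "'a::topological_space convolution \<Rightarrow> 'a \<Rightarrow> ('a \<Rightarrow> complex) \<Rightarrow> 'a \<Rightarrow> complex" where
  "right_translate conv y f = (\<lambda>x. conv_eval conv f x y)"

definition left_orbit ::
    "'a::topological_space convolution \<Rightarrow> ('a \<Rightarrow> complex) \<Rightarrow> ('a \<Rightarrow> complex) set" where
  "left_orbit conv f = {left_translate conv x f |x. True}"

definition right_orbit ::
    "'a::topological_space convolution \<Rightarrow> ('a \<Rightarrow> complex) \<Rightarrow> ('a \<Rightarrow> complex) set" where
  "right_orbit conv f = {right_translate conv x f |x. True}"

text \<open>
  \<open>C(K)\<close> is the type \<open>'a \<Rightarrow>\<^sub>C complex\<close>. The library only makes it a real normed space, so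
  complex homogeneity of the functionals defining the weak topology is spelled out pointwise.
\<close>

definition complex_dual :: "(('a::topological_space \<Rightarrow>\<^sub>C complex) \<Rightarrow> complex) set" where
  "complex_dual = {\<phi>. bounded_linear \<phi> \<and>
     (\<forall>c f g. (\<forall>x. apply_bcontfun g x = c * apply_bcontfun f x) \<longrightarrow> \<phi> g = c * \<phi> f)}"

definition weak_topology :: "('a::topological_space \<Rightarrow>\<^sub>C complex) topology" where
  "weak_topology = topology_generated_by {\<phi> -` W |\<phi> W. \<phi> \<in> complex_dual \<and> open W}"

text \<open>
  Relative compactness of a set \<open>S\<close> of functions in \<open>C(K)\<close> with respect to a topology on \<open>C(K)\<close>;
  it includes the requirement that \<open>S\<close> consist of bounded continuous functions, without which
  \<open>Bcontfun\<close> is unspecified.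
\<close>

definition relatively_compact_in ::
    "('a::topological_space \<Rightarrow>\<^sub>C complex) topology \<Rightarrow> ('a \<Rightarrow> complex) set \<Rightarrow> bool" where
  "relatively_compact_in T S \<longleftrightarrow> S \<subseteq> bcontfun \<and> compactin T (T closure_of (Bcontfun ` S))"

definition WAP_l :: "'a::topological_space convolution \<Rightarrow> ('a \<Rightarrow>\<^sub>C complex) set" where
  "WAP_l conv = {f. relatively_compact_in weak_topology (left_orbit conv (apply_bcontfun f))}"

definition WAP_r :: "'a::topological_space convolution \<Rightarrow> ('a \<Rightarrow>\<^sub>C complex) set" where
  "WAP_r conv = {f. relatively_compact_in weak_topology (right_orbit conv (apply_bcontfun f))}"

definition AP_l :: "'a::topological_space convolution \<Rightarrow> ('a \<Rightarrow>\<^sub>C complex) set" where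
  "AP_l conv = {f. relatively_compact_in euclidean (left_orbit conv (apply_bcontfun f))}"

definition AP_r :: "'a::topological_space convolution \<Rightarrow> ('a \<Rightarrow>\<^sub>C complex) set" where
  "AP_r conv = {f. relatively_compact_in euclidean (right_orbit conv (apply_bcontfun f))}"

text \<open>
  For a semihypergroup \<open>AP_l\<close> and \<open>AP_r\<close> coincide, so the choice of side is immaterial there.
\<close>

definition AP :: "'a::topological_space convolution \<Rightarrow> ('a \<Rightarrow>\<^sub>C complex) set" where
  "AP conv = AP_l conv"

end

theory Submission
  imports Defs
begin

text \<open>
  On a compact space every continuous function is, up to an additive constant, a non-negative
  function of compact support, so the cone topology controls the integrals of all continuous
  functions against probability measures. Point masses depend continuously on their base point,
  and convolution is jointly continuous; hence \<open>F (x, y) = f (x * y)\<close> is jointly continuous on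
  \<open>K \<times> K\<close> for each \<open>f \<in> C(K)\<close> (\<open>continuous_on_conv_eval\<close>).

  Since \<open>K\<close> is compact, such an \<open>F\<close> can be curried: \<open>x \<mapsto> F (x, \<cdot>)\<close> is a continuous map from \<open>K\<close>
  into \<open>C(K)\<close> with the supremum norm (\<open>continuous_on_curry_Bcontfun\<close>). Each orbit is the image of
  \<open>K\<close> under a map of this kind, so it is norm compact, and a fortiori weakly compact. Both
  topologies on \<open>C(K)\<close> are Hausdorff, so the orbit is closed and coincides with its closure
  (\<open>relatively_compact_in_slices\<close>). Thus each of the four spaces is all of \<open>C(K)\<close>.
\<close>

section \<open>Positive measures and point masses\<close>

lemma sets_to_measure [simp, measurable_cong]: "sets (to_measure \<mu>) = sets borel"
  by (simp add: to_measure_def sets.sigma_sets_eq[of borel, simplified])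

lemma space_to_measure [simp]: "space (to_measure \<mu>) = UNIV"
  by (simp add: to_measure_def)

lemma emeasure_to_measure:
  assumes "\<mu> \<in> \<M>\<^sub>+" "E \<in> sets borel"
  shows "emeasure (to_measure \<mu>) E = ennreal (Re (\<mu> E))"
proof -
  have sums: "(\<lambda>i. \<mu> (A i)) sums \<mu> (\<Union>i. A i)"
    if "range A \<subseteq> sets borel" "disjoint_family A" for A :: "nat \<Rightarrow> 'a set"
    using assms(1) that by (auto simp: pos_measures_def complex_measures_def complex_borel_measure_def)
  have nonneg: "0 \<le> Re (\<mu> A)" for A
    using assms(1) by (auto simp: pos_measures_def complex_nonneg_Reals_iff)
  \<comment> \<open>The constantly empty family makes a constant sequence summable.\<close>
  have "(\<lambda>i::nat. \<mu> {}) sums \<mu> {}"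
    using sums[of "\<lambda>_. {}"] by (simp add: disjoint_family_on_def)
  then have "\<mu> {} = 0"
    using sums_summable summable_const_iff by blast
  then have pos: "positive (sets borel) (\<lambda>E. ennreal (Re (\<mu> E)))"
    by (simp add: positive_def)
  have "countably_additive (sets borel) (\<lambda>E. ennreal (Re (\<mu> E)))"
    unfolding countably_additive_def
    by (intro allI impI sums_unique[symmetric])
      (simp add: sums_ennreal nonneg sums_Re sums)
  then show ?thesis
    unfolding to_measure_def
    using emeasure_measure_of_sigma[OF _ pos _ assms(2)] sets.sigma_algebra_axioms[of borel]
    by simp
qed

lemma total_variation_point_mass:
  assumes E: "E \<in> sets borel"
  shows "total_variation (point_mass x) E = indicator E x"
proof -
  define \<A> where
    "\<A> = {A :: nat \<Rightarrow> 'a set. range A \<subseteq> sets borel \<and> disjoint_family A \<and> (\<Union>i. A i) = E}"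
  have "(\<Sum>i. ennreal (cmod (point_mass x (A i)))) = indicator E x" if "A \<in> \<A>" for A
  proof -
    have "ennreal (cmod (point_mass x (A i))) = indicator (A i) x" for i
      using that by (auto simp: \<A>_def point_mass_def indicator_def)
    then show ?thesis
      using that suminf_indicator[of A x] by (simp add: \<A>_def)
  qed
  moreover have "(\<lambda>n. if n = 0 then E else {}) \<in> \<A>"
    using E by (auto simp: \<A>_def disjoint_family_on_def split: if_splits)
  ultimately have "(SUP A \<in> \<A>. \<Sum>i. ennreal (cmod (point_mass x (A i)))) = indicator E x"
    by (intro SUP_eqI) auto
  then show ?thesis
    by (simp add: total_variation_def \<A>_def)
qed

text \<open>
  The axioms on convolution only concern regular measures. Regularity of a point mass comes from
  total variation \<open>E \<mapsto> indicator E x\<close>: the open set \<open>- {x}\<close> is optimal from outside when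
  \<open>x \<notin> E\<close>, and the compact set \<open>E \<inter> {x}\<close> is always optimal from inside.
\<close>

lemma point_mass_in_pos_measures:
  fixes x :: "'a::t2_space"
  shows "point_mass x \<in> \<M>\<^sub>+"
proof -
  have "(\<lambda>i. point_mass x (A i)) sums point_mass x (\<Union>i. A i)"
    if A: "range A \<subseteq> sets borel" "disjoint_family A" for A :: "nat \<Rightarrow> 'a set"
  proof (cases "x \<in> (\<Union>i. A i)")
    case True
    then obtain i where i: "x \<in> A i" by blast
    then have "x \<notin> A j" if "j \<noteq> i" for j
      using A(2) that by (auto simp: disjoint_family_on_def)
    then have "(\<lambda>j. point_mass x (A j)) = (\<lambda>j. if j = i then 1 else 0)"
      using A(1) i by (fastforce simp: point_mass_def)
    moreover have "point_mass x (\<Union>i. A i) = 1"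
      using A(1) True by (auto simp: point_mass_def)
    ultimately show ?thesis
      using sums_single[of i "\<lambda>_. 1 :: complex"] by simp
  next
    case False
    then have "point_mass x (A i) = 0" for i
      by (simp add: point_mass_def)
    moreover have "point_mass x (\<Union>i. A i) = 0"
      using False by (simp add: point_mass_def)
    ultimately show ?thesis by simp
  qed
  then have "complex_borel_measure (point_mass x)"
    unfolding complex_borel_measure_def by (simp add: point_mass_def)
  moreover have "regular_complex_measure (point_mass x)"
    unfolding regular_complex_measure_def
  proof (intro ballI conjI)
    fix E :: "'a set" assume E: "E \<in> sets borel"
    have "indicator E x = (INF U \<in> {U. open U \<and> E \<subseteq> U}. indicator U x :: ennreal)"
    proof (cases "x \<in> E")
      case True
      then have "(INF U \<in> {U. open U \<and> E \<subseteq> U}. indicator U x :: ennreal)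
          = (INF U \<in> {U. open U \<and> E \<subseteq> U}. 1)"
        by (intro INF_cong) (auto simp: indicator_def)
      also have "\<dots> = 1"
        by (intro cINF_const) blast
      finally show ?thesis using True by simp
    next
      case False
      then have "(INF U \<in> {U. open U \<and> E \<subseteq> U}. indicator U x :: ennreal) \<le> indicator (- {x}) x"
        by (intro INF_lower) auto
      then show ?thesis using False by simp
    qed
    then show "total_variation (point_mass x) E
        = (INF U \<in> {U. open U \<and> E \<subseteq> U}. total_variation (point_mass x) U)"
      using E by (simp add: total_variation_point_mass)
  next
    fix E :: "'a set" assume E: "E \<in> sets borel"
    have "(SUP C \<in> {C. compact C \<and> C \<subseteq> E}. indicator C x :: ennreal) = indicator E x"
    proof (intro antisym SUP_least)
      show "(indicator C x :: ennreal) \<le> indicator E x" if "C \<in> {C. compact C \<and> C \<subseteq> E}" for C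
        using that by (auto simp: indicator_def)
    next
      have "(indicator (E \<inter> {x}) x :: ennreal)
          \<le> (SUP C \<in> {C. compact C \<and> C \<subseteq> E}. indicator C x)"
        by (intro SUP_upper) (simp add: Int_insert_right)
      then show "(indicator E x :: ennreal) \<le> (SUP C \<in> {C. compact C \<and> C \<subseteq> E}. indicator C x)"
        by (simp add: indicator_def)
    qed
    moreover have "(SUP C \<in> {C. compact C \<and> C \<subseteq> E}. total_variation (point_mass x) C)
        = (SUP C \<in> {C. compact C \<and> C \<subseteq> E}. indicator C x)"
      by (intro SUP_cong refl total_variation_point_mass) (auto dest: compact_imp_closed)
    ultimately show "total_variation (point_mass x) E
        = (SUP C \<in> {C. compact C \<and> C \<subseteq> E}. total_variation (point_mass x) C)"
      using E by (simp add: total_variation_point_mass)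
  qed
  moreover have "point_mass x E \<in> \<real>\<^sub>\<ge>\<^sub>0" for E
    by (simp add: point_mass_def indicator_def)
  ultimately show ?thesis
    by (simp add: pos_measures_def complex_measures_def)
qed

lemma integral_point_mass:
  fixes x :: "'a::t2_space" and f :: "'a \<Rightarrow> real"
  assumes "f \<in> borel_measurable borel"
  shows "(\<integral>y. f y \<partial>to_measure (point_mass x)) = f x"
proof -
  have em: "emeasure (to_measure (point_mass x)) E = indicator E x" if "E \<in> sets borel" for E
    using that unfolding emeasure_to_measure[OF point_mass_in_pos_measures that]
    by (simp add: point_mass_def indicator_def)
  have "- {x} \<in> null_sets (to_measure (point_mass x))"
    by (simp add: null_sets_def em)
  then have "AE y in to_measure (point_mass x). f y = f x"
    by (rule AE_I') auto
  then have "(\<integral>y. f y \<partial>to_measure (point_mass x)) = (\<integral>y. f x \<partial>to_measure (point_mass x))"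
    using assms by (intro integral_cong_AE) auto
  also have "\<dots> = f x"
    by (simp add: measure_def em)
  finally show ?thesis .
qed

section \<open>The cone topology\<close>

lemma topspace_cone_topology [simp]: "topspace cone_topology = \<M>\<^sub>+"
  unfolding cone_topology_def topology_generated_by_topspace by blast

lemma continuous_map_integral_cone_topology:
  assumes "f \<in> Cc_plus"
  shows "continuous_map cone_topology euclidean (\<lambda>\<mu>. \<integral>x. f x \<partial>to_measure \<mu>)"
  unfolding continuous_map_def
proof (intro conjI allI impI)
  fix W :: "real set" assume "openin euclidean W"
  then show "openin cone_topology {\<mu> \<in> topspace cone_topology. (\<integral>x. f x \<partial>to_measure \<mu>) \<in> W}"
    using assms unfolding topspace_cone_topology unfolding cone_topology_def
    by (intro topology_generated_by_Basis) auto
qed simp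

lemma continuous_map_point_mass:
  "continuous_map euclidean cone_topology (point_mass :: 'a::t2_space \<Rightarrow> _)"
  unfolding cone_topology_def
proof (rule continuous_on_generated_topo)
  fix S :: "('a set \<Rightarrow> complex) set"
  assume "S \<in> {{\<mu> \<in> \<M>\<^sub>+. (\<integral>x. f x \<partial>to_measure \<mu>) \<in> W} |f W. f \<in> Cc_plus \<union> {\<lambda>_. 1} \<and> open W}"
  then obtain f W where S: "S = {\<mu> \<in> \<M>\<^sub>+. (\<integral>x. f x \<partial>to_measure \<mu>) \<in> W}"
    and "f \<in> Cc_plus \<union> {\<lambda>_. 1}" and W: "open W"
    by blast
  then have f: "continuous_on UNIV f"
    by (auto simp: Cc_plus_def)
  have "point_mass -` S = f -` W"
    by (auto simp: S point_mass_in_pos_measures integral_point_mass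
        borel_measurable_continuous_onI[OF f])
  then show "openin euclidean (point_mass -` S \<inter> topspace euclidean)"
    using f W by (simp add: open_vimage)
qed (use point_mass_in_pos_measures in blast)

section \<open>Joint continuity of \<open>f (x * y)\<close>\<close>

context semihypergroup
begin

lemma conv_point_mass_in_pos_measures: "point_mass x \<star> point_mass y \<in> \<M>\<^sub>+"
  by (intro conv_pos point_mass_in_pos_measures)

lemma emeasure_conv_point_mass_UNIV: "emeasure (to_measure (point_mass x \<star> point_mass y)) UNIV = 1"
  by (simp add: emeasure_to_measure conv_point_mass_in_pos_measures conv_prob)

lemma integrable_conv_point_mass:
  fixes f :: "'a \<Rightarrow> 'b::{banach, second_countable_topology}"
  assumes "compact (UNIV :: 'a set)" "continuous_on UNIV f"
  shows "integrable (to_measure (point_mass x \<star> point_mass y)) f"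
proof -
  interpret finite_measure "to_measure (point_mass x \<star> point_mass y)"
    by standard (simp add: emeasure_conv_point_mass_UNIV)
  obtain B where "norm (f z) \<le> B" for z
    using compact_imp_bounded[OF compact_continuous_image[OF assms(2,1)]]
    by (auto simp: bounded_iff)
  moreover have "f \<in> borel_measurable borel"
    using assms(2) by (rule borel_measurable_continuous_onI)
  ultimately show ?thesis
    by (intro integrable_const_bound[of _ B]) auto
qed

text \<open>
  The cone topology only tests against non-negative functions, so a real function \<open>g\<close> bounded by
  \<open>B\<close> is replaced by \<open>g + B\<close>, which has compact support because the space is compact. Since
  \<open>p\<^sub>x * p\<^sub>y\<close> has mass one, the shift changes each integral by exactly \<open>B\<close>.
\<close>

lemma continuous_on_integral_conv_point_mass:
  fixes g :: "'a \<Rightarrow> real"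
  assumes K: "compact (UNIV :: 'a set)" and g: "continuous_on UNIV g"
  shows "continuous_on UNIV (\<lambda>(x, y). \<integral>z. g z \<partial>to_measure (point_mass x \<star> point_mass y))"
proof -
  obtain B where B: "\<bar>g z\<bar> \<le> B" for z
    using compact_imp_bounded[OF compact_continuous_image[OF g K]]
    by (auto simp: bounded_iff)
  have "compact (closure {z. g z + B \<noteq> 0})"
    using compact_Int_closed[OF K closed_closure] by simp
  moreover have "0 \<le> g z + B" for z
    using B[of z] by simp
  ultimately have "(\<lambda>z. g z + B) \<in> Cc_plus"
    using g by (auto simp: Cc_plus_def intro!: continuous_intros)
  then have int: "continuous_map cone_topology euclidean (\<lambda>\<mu>. \<integral>z. g z + B \<partial>to_measure \<mu>)"
    by (rule continuous_map_integral_cone_topology)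
  have "continuous_map (prod_topology euclidean euclidean) (prod_topology cone_topology cone_topology)
      (\<lambda>p :: 'a \<times> 'a. (point_mass (fst p), point_mass (snd p)))"
    by (intro continuous_map_pairedI continuous_map_compose[OF _ continuous_map_point_mass, unfolded o_def]
        continuous_map_fst continuous_map_snd)
  from continuous_map_compose[OF continuous_map_compose[OF this conv_continuous] int]
  have "continuous_on UNIV
      (\<lambda>p. (\<integral>z. g z + B \<partial>to_measure (point_mass (fst p) \<star> point_mass (snd p))) - B)"
    by (intro continuous_intros) (simp add: o_def)
  moreover have "(\<integral>z. g z + B \<partial>to_measure (point_mass x \<star> point_mass y)) - B
      = (\<integral>z. g z \<partial>to_measure (point_mass x \<star> point_mass y))" for x y
  proof -
    have "(\<integral>z. g z + B \<partial>to_measure (point_mass x \<star> point_mass y))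
        = (\<integral>z. g z \<partial>to_measure (point_mass x \<star> point_mass y))
          + (\<integral>z. B \<partial>to_measure (point_mass x \<star> point_mass y))"
      by (intro Bochner_Integration.integral_add integrable_conv_point_mass K g continuous_intros)
    then show ?thesis
      by (simp add: measure_def emeasure_conv_point_mass_UNIV)
  qed
  ultimately show ?thesis
    by (simp add: case_prod_unfold)
qed

lemma continuous_on_conv_eval:
  assumes K: "compact (UNIV :: 'a set)" and f: "continuous_on UNIV f"
  shows "continuous_on UNIV (\<lambda>(x, y). conv_eval (\<star>) f x y)"
proof -
  have "conv_eval (\<star>) f x y
      = complex_of_real (\<integral>z. Re (f z) \<partial>to_measure (point_mass x \<star> point_mass y))
        + \<i> * complex_of_real (\<integral>z. Im (f z) \<partial>to_measure (point_mass x \<star> point_mass y))" for x y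
    using integrable_conv_point_mass[OF K f, of x y]
    by (simp add: conv_eval_def complex_eq_iff)
  then show ?thesis
    using continuous_on_integral_conv_point_mass[OF K continuous_on_Re[OF f]]
      continuous_on_integral_conv_point_mass[OF K continuous_on_Im[OF f]]
    by (auto simp: case_prod_unfold intro!: continuous_intros)
qed

end

section \<open>Compactness of orbits in the two topologies of \<open>C(K)\<close>\<close>

lemma continuous_on_slice_bcontfun:
  fixes F :: "'a::topological_space \<times> 'b::topological_space \<Rightarrow> 'c::metric_space"
  assumes "compact (UNIV :: 'b set)" "continuous_on UNIV F"
  shows "(\<lambda>y. F (x, y)) \<in> bcontfun"
proof -
  have "continuous_on UNIV (\<lambda>y. F (x, y))"
    by (intro continuous_on_compose2[OF assms(2)] continuous_intros) auto
  then show ?thesis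
    using compact_imp_bounded[OF compact_continuous_image[OF _ assms(1)]]
    by (auto simp: bcontfun_def)
qed

text \<open>
  Compactness of the second factor makes the continuity of \<open>F\<close> in its first argument uniform in
  the second, which is continuity for the supremum distance.
\<close>

lemma continuous_on_curry_Bcontfun:
  fixes F :: "'a::topological_space \<times> 'b::topological_space \<Rightarrow> 'c::metric_space"
  assumes K: "compact (UNIV :: 'b set)" and F: "continuous_on UNIV F"
  shows "continuous_on UNIV (\<lambda>x. Bcontfun (\<lambda>y. F (x, y)))"
  unfolding continuous_on_def
proof (intro ballI tendstoI)
  fix x :: 'a and e :: real assume "e > 0"
  then have "e / 2 > 0" by simp
  have "continuous_on (UNIV \<times> UNIV) F" using F by simp
  from this K UNIV_I \<open>e / 2 > 0\<close> obtain X where X: "x \<in> X" "open X"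
    "\<forall>x'\<in>X \<inter> UNIV. \<forall>y\<in>UNIV. dist (F (x', y)) (F (x, y)) \<le> e / 2"
    by (rule continuous_on_prod_compactE)
  have "dist (Bcontfun (\<lambda>y. F (x', y))) (Bcontfun (\<lambda>y. F (x, y))) < e" if "x' \<in> X" for x'
  proof -
    have "dist (Bcontfun (\<lambda>y. F (x', y))) (Bcontfun (\<lambda>y. F (x, y))) \<le> e / 2"
    proof (rule dist_bound)
      fix y
      have "dist (F (x', y)) (F (x, y)) \<le> e / 2"
        using X(3) that by blast
      then show "dist (apply_bcontfun (Bcontfun (\<lambda>y. F (x', y))) y)
          (apply_bcontfun (Bcontfun (\<lambda>y. F (x, y))) y) \<le> e / 2"
        unfolding Bcontfun_inverse[OF continuous_on_slice_bcontfun[OF K F]] .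
    qed
    then show ?thesis using \<open>e > 0\<close> by simp
  qed
  then show "\<forall>\<^sub>F x' in at x within UNIV.
      dist (Bcontfun (\<lambda>y. F (x', y))) (Bcontfun (\<lambda>y. F (x, y))) < e"
    using X(1,2) unfolding eventually_at_topological by blast
qed

lemma continuous_map_weak_topology: "continuous_map euclidean weak_topology id"
  unfolding weak_topology_def
proof (rule continuous_on_generated_topo)
  fix U :: "('a \<Rightarrow>\<^sub>C complex) set"
  assume "U \<in> {\<phi> -` W |\<phi> W. \<phi> \<in> complex_dual \<and> open W}"
  then obtain \<phi> W where U: "U = \<phi> -` W" and "\<phi> \<in> complex_dual" and W: "open W"
    by blast
  then have \<phi>: "bounded_linear \<phi>"
    by (simp add: complex_dual_def)
  show "openin euclidean (id -` U \<inter> topspace euclidean)"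
    using open_vimage[OF W linear_continuous_on[OF \<phi>]] by (simp add: U)
next
  have "(\<lambda>_. 0) \<in> complex_dual"
    by (simp add: complex_dual_def bounded_linear_zero)
  then show "id ` topspace euclidean \<subseteq>
      \<Union>{\<phi> -` W |\<phi> W. (\<phi> :: ('a \<Rightarrow>\<^sub>C complex) \<Rightarrow> complex) \<in> complex_dual \<and> open W}"
    by (auto intro!: exI[of _ UNIV])
qed

text \<open>
  Point evaluations belong to the dual and already separate functions, so the Hausdorff property
  does not depend on the Hahn-Banach theorem.
\<close>

lemma Hausdorff_space_weak_topology: "Hausdorff_space weak_topology"
  unfolding Hausdorff_space_def
proof (intro allI impI)
  fix f g :: "'a \<Rightarrow>\<^sub>C complex"
  assume "f \<in> topspace weak_topology \<and> g \<in> topspace weak_topology \<and> f \<noteq> g"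
  then obtain x where "apply_bcontfun f x \<noteq> apply_bcontfun g x"
    using bcontfun_eqI by blast
  then obtain V W where VW: "open V" "open W" "apply_bcontfun f x \<in> V" "apply_bcontfun g x \<in> W"
      "V \<inter> W = {}"
    by (meson hausdorff)
  define \<delta> where "\<delta> = (\<lambda>h :: 'a \<Rightarrow>\<^sub>C complex. apply_bcontfun h x)"
  have "bounded_linear \<delta>"
    by (rule bounded_linear_intro[of _ 1]) (auto simp: \<delta>_def norm_bounded)
  then have "\<delta> \<in> complex_dual"
    by (simp add: complex_dual_def \<delta>_def)
  then have "openin weak_topology (\<delta> -` V)" "openin weak_topology (\<delta> -` W)"
    using VW(1,2) by (auto simp: weak_topology_def intro!: topology_generated_by_Basis)
  moreover have "f \<in> \<delta> -` V" "g \<in> \<delta> -` W" "disjnt (\<delta> -` V) (\<delta> -` W)"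
    using VW(3-5) by (auto simp: \<delta>_def disjnt_def)
  ultimately show "\<exists>U V. openin weak_topology U \<and> openin weak_topology V \<and> f \<in> U \<and> g \<in> V \<and> disjnt U V"
    by blast
qed

text \<open>
  The hypotheses on \<open>T\<close> are what the norm topology and the weak topology have in common. Being
  coarser than the norm topology makes the set of slices compact in \<open>T\<close>; the Hausdorff property
  makes this compact set closed, so that passing to the closure adds nothing.
\<close>

lemma relatively_compact_in_slices:
  fixes F :: "'a::topological_space \<times> 'b::topological_space \<Rightarrow> complex"
  assumes "compact (UNIV :: 'a set)" "compact (UNIV :: 'b set)" "continuous_on UNIV F"
    and T: "continuous_map euclidean T id" "Hausdorff_space T"
  shows "relatively_compact_in T (range (\<lambda>x y. F (x, y)))"
proof -
  have "compactin euclidean (range (\<lambda>x. Bcontfun (\<lambda>y. F (x, y))))"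
    using compact_continuous_image[OF continuous_on_curry_Bcontfun[OF assms(2,3)] assms(1)] by simp
  from image_compactin[OF this T(1)]
  have "compactin T (Bcontfun ` range (\<lambda>x y. F (x, y)))"
    by (simp add: image_image)
  then show ?thesis
    using compactin_imp_closedin[OF T(2)] continuous_on_slice_bcontfun[OF assms(2,3)]
    by (auto simp: relatively_compact_in_def closure_of_closedin)
qed

lemma (in semihypergroup) relatively_compact_in_orbits:
  assumes K: "compact (UNIV :: 'a set)" and f: "continuous_on UNIV f"
    and T: "continuous_map euclidean T id" "Hausdorff_space T"
  shows "relatively_compact_in T (left_orbit (\<star>) f)" "relatively_compact_in T (right_orbit (\<star>) f)"
proof -
  have F: "continuous_on UNIV (\<lambda>(x, y). conv_eval (\<star>) f x y)"
    by (rule continuous_on_conv_eval[OF K f])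
  then have "continuous_on UNIV (\<lambda>(y, x). conv_eval (\<star>) f x y)"
    using continuous_on_compose2[OF F continuous_on_swap, of UNIV]
    by (simp add: case_prod_unfold)
  from relatively_compact_in_slices[OF K K F T] relatively_compact_in_slices[OF K K this T]
  show "relatively_compact_in T (left_orbit (\<star>) f)" "relatively_compact_in T (right_orbit (\<star>) f)"
    by (simp_all add: left_orbit_def right_orbit_def left_translate_def right_translate_def full_SetCompr_eq)
qed

theorem theorem4p11:
  fixes conv :: "'a::t2_space convolution"
  assumes "semihypergroup conv"
    and "compact (UNIV :: 'a set)"
  shows "AP_r conv = AP conv \<and> AP conv = WAP_l conv \<and> WAP_l conv = WAP_r conv \<and>
         WAP_r conv = (UNIV :: ('a \<Rightarrow>\<^sub>C complex) set)"
proof -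
  note orbits = semihypergroup.relatively_compact_in_orbits[OF assms continuous_on_apply_bcontfun]
  have "Hausdorff_space (euclidean :: ('a \<Rightarrow>\<^sub>C complex) topology)"
    by (rule Hausdorff_space_euclidean)
  note norm = orbits[OF continuous_map_id this]
  note weak = orbits[OF continuous_map_weak_topology Hausdorff_space_weak_topology]
  show ?thesis
    by (simp add: AP_def AP_l_def AP_r_def WAP_l_def WAP_r_def norm weak)
qed

end
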